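(* Let $n\ge 1$ and $r\geq 0$ be integers. There is a bijection between the set $\operatorname{Av}_n(2\square^{r}1)$ and the set of permutations $\sigma\in S_n$ such that any two elements belonging to the same cycle of $\sigma$ differ by at most $r$. (In particular the two sets have the same cardinality.)
   Context: $S_n$ is the set of permutations of $[n]=\{1,\dots,n\}$, written in one-line notation $p=p_1p_2\cdots p_n$. The symbol $\square^r$ between two letters of a pattern means that in an occurrence there must be at least $r$ other letters between them. Thus $\operatorname{Av}_n(2\square^{r}1)$ is the set of all $p\in S_n$ for which there are no positions $i<j$ with $j-i>r$ and $p_i>p_j$. *)

theory Defs
  imports "HOL-Combinatorics.Permutations" "HOL-Combinatorics.Orbits"
begin

text \<open>
  A permutation of \<open>[n]\<close> is a function \<open>p\<close> with \<open>p permutes {1..n}\<close>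
  (so \<open>p\<close> is the identity outside \<open>{1..n}\<close>); the letter at position \<open>i\<close> of its one-line
  notation is \<open>p i\<close>.
\<close>

definition perms_upto :: "nat \<Rightarrow> (nat \<Rightarrow> nat) set" where
  "perms_upto n = {p. p permutes {1..n}}"

text \<open>
  At least \<open>r\<close> letters lie strictly between positions \<open>i < j\<close> iff \<open>j - i - 1 \<ge> r\<close>,
  that is, \<open>j - i > r\<close>.
\<close>

definition occurs_2gap1 :: "nat \<Rightarrow> nat \<Rightarrow> (nat \<Rightarrow> nat) \<Rightarrow> bool" where
  "occurs_2gap1 n r p \<longleftrightarrow>
     (\<exists>i\<in>{1..n}. \<exists>j\<in>{1..n}. i < j \<and> j - i > r \<and> p i > p j)"

definition Av_2gap1 :: "nat \<Rightarrow> nat \<Rightarrow> (nat \<Rightarrow> nat) set" where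
  "Av_2gap1 n r = {p \<in> perms_upto n. \<not> occurs_2gap1 n r p}"

text \<open>
  The cycle of \<open>\<sigma>\<close> containing \<open>a\<close> is \<open>orbit \<sigma> a\<close>; fixed points are cycles of length 1.
\<close>

definition cycles_within :: "nat \<Rightarrow> nat \<Rightarrow> (nat \<Rightarrow> nat) set" where
  "cycles_within n r =
     {\<sigma> \<in> perms_upto n.
        \<forall>a\<in>{1..n}. \<forall>b\<in>orbit \<sigma> a. \<bar>int a - int b\<bar> \<le> int r}"

end

theory Submission
  imports Defs "HOL-Library.FuncSet"
begin

text \<open>
  Both sets are encoded by the functions \<open>c\<close> on \<open>{1..n}\<close> with \<open>k \<le> c k \<le> n\<close>, of which there are
  \<open>n!\<close>. Reading \<open>p j\<close> as the position of the value \<open>j\<close> (that is, passing to the inverse word), let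
  \<open>c k\<close> be the last value exceeding \<open>k\<close> that is placed before \<open>k\<close>, or \<open>k\<close> if there is none. On the
  other side \<open>c\<close> gives the permutation \<open>(1 c\<^sub>1)(2 c\<^sub>2)\<dots>(n c\<^sub>n)\<close>. In both pictures the largest element
  of the block of \<open>k\<close> (the largest value placed before \<open>k\<close> or at \<open>k\<close>, respectively the largest
  element of the cycle of \<open>k\<close>) is what iterating \<open>c\<close> from \<open>k\<close> leads to. So avoidance and the cycle
  condition both say that no iterate of \<open>c\<close> exceeds its starting point by more than \<open>r\<close>. The
  composite is a form of Foata's fundamental bijection.
\<close>

definition codes :: "nat \<Rightarrow> (nat \<Rightarrow> nat) set" where
  "codes n = (\<Pi>\<^sub>E k\<in>{1..n}. {k..n})"

definition short_code :: "nat \<Rightarrow> nat \<Rightarrow> (nat \<Rightarrow> nat) \<Rightarrow> bool" where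
  "short_code n r c \<longleftrightarrow> (\<forall>x\<in>{1..n}. \<forall>i. (c ^^ i) x \<le> x + r)"

lemma finite_codes: "finite (codes n)"
  unfolding codes_def by (intro finite_PiE) auto

lemma card_codes: "card (codes n) = fact n"
proof -
  have "card (codes n) = (\<Prod>k=1..n. n + 1 - k)"
    unfolding codes_def by (subst card_PiE) (auto intro!: prod.cong)
  also have "\<dots> = \<Prod>{1..n}"
    by (rule prod.reindex_bij_witness[of _ "\<lambda>k. n + 1 - k" "\<lambda>k. n + 1 - k"]) auto
  finally show ?thesis by (simp add: fact_prod)
qed

lemma finite_perms_upto: "finite (perms_upto n)"
  unfolding perms_upto_def by (rule finite_permutations) simp

lemma card_perms_upto: "card (perms_upto n) = fact n"
  unfolding perms_upto_def by (rule card_permutations) auto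

lemma codesD:
  assumes "c \<in> codes n" "x \<in> {1..n}"
  shows "x \<le> c x" "c x \<in> {1..n}"
proof -
  have "c x \<in> {x..n}" using assms unfolding codes_def by (rule PiE_mem)
  then show "x \<le> c x" "c x \<in> {1..n}" using assms(2) by auto
qed

lemma codes_funpow:
  assumes "c \<in> codes n" "x \<in> {1..n}"
  shows "x \<le> (c ^^ i) x \<and> (c ^^ i) x \<in> {1..n}"
proof (induction i)
  case (Suc i)
  then show ?case using codesD[OF assms(1), of "(c ^^ i) x"] by auto
qed (use assms in auto)


subsection \<open>Codes of one-line notations\<close>

definition word_code :: "nat \<Rightarrow> (nat \<Rightarrow> nat) \<Rightarrow> nat \<Rightarrow> nat" where
  "word_code n p = (\<lambda>k\<in>{1..n}.
     if \<exists>j\<in>{k<..n}. p j < p k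
     then ARG_MAX p j. j \<in> {k<..n} \<and> p j < p k
     else k)"

lemma word_code_cases:
  assumes "k \<in> {1..n}"
  obtains (none) "word_code n p k = k" "\<And>j. j \<in> {k<..n} \<Longrightarrow> \<not> p j < p k"
  | (some) "word_code n p k \<in> {k<..n}" "p (word_code n p k) < p k"
      "\<And>j. j \<in> {k<..n} \<Longrightarrow> p j < p k \<Longrightarrow> p j \<le> p (word_code n p k)"
proof (cases "\<exists>j\<in>{k<..n}. p j < p k")
  case True
  let ?P = "\<lambda>j. j \<in> {k<..n} \<and> p j < p k"
  obtain j0 where "?P j0" using True by blast
  moreover have "\<forall>j. ?P j \<longrightarrow> p j < p k" by blast
  ultimately have "?P (arg_max p ?P) \<and> (\<forall>j. ?P j \<longrightarrow> p j \<le> p (arg_max p ?P))"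
    by (rule arg_max_nat_lemma)
  moreover have "word_code n p k = arg_max p ?P"
    using assms True by (simp add: word_code_def)
  ultimately show thesis using some by presburger
next
  case False
  then show thesis using none assms by (auto simp: word_code_def)
qed

lemma word_code_in_codes: "word_code n p \<in> codes n"
  unfolding codes_def
proof (rule PiE_I)
  fix k assume k: "k \<in> {1..n}"
  then show "word_code n p k \<in> {k..n}" by (cases rule: word_code_cases[of k n p]) (use k in auto)
qed (simp add: word_code_def del: atLeastAtMost_iff)

text \<open>The code of \<open>k\<close> is the latest placed among the larger values preceding
  \<open>k\<close>. So in the word of the values above \<open>k\<close>, those preceding
  \<open>k\<close> form an initial segment ending at the code.\<close>

lemma word_code_before:
  assumes "p permutes {1..n}" "k \<in> {1..n}" "j \<in> {k<..n}"
  shows "p j < p k \<longleftrightarrow> word_code n p k \<noteq> k \<and> p j \<le> p (word_code n p k)"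
  using assms(2)
proof (cases rule: word_code_cases[of k n p])
  case none
  then show ?thesis using assms(3) by auto
next
  case some
  then show ?thesis using assms(3) by fastforce
qed

text \<open>The values placed no later than \<open>i\<close> fill exactly the positions up to
  \<open>p i\<close>. This recovers \<open>p\<close> from the mere order in which it places the
  values.\<close>

lemma permutes_rank:
  assumes "p permutes {1..n::nat}" "i \<in> {1..n}"
  shows "p i = card {j \<in> {1..n}. p j \<le> p i}"
proof -
  have "p ` {j \<in> {1..n}. p j \<le> p i} = {1..p i}"
  proof
    show "p ` {j \<in> {1..n}. p j \<le> p i} \<subseteq> {1..p i}"
      using permutes_image[OF assms(1)] by fastforce
    show "{1..p i} \<subseteq> p ` {j \<in> {1..n}. p j \<le> p i}"
    proof
      fix y assume y: "y \<in> {1..p i}"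
      moreover have "p i \<in> {1..n}" using permutes_in_image[OF assms(1)] assms(2) by blast
      ultimately have "y \<in> p ` {1..n}" using permutes_image[OF assms(1)] by auto
      then show "y \<in> p ` {j \<in> {1..n}. p j \<le> p i}" using y by auto
    qed
  qed
  moreover have "card (p ` {j \<in> {1..n}. p j \<le> p i}) = card {j \<in> {1..n}. p j \<le> p i}"
    by (intro card_image inj_on_subset[OF permutes_inj[OF assms(1)]]) auto
  ultimately show ?thesis by simp
qed

text \<open>The word is rebuilt by inserting the values in decreasing order: \<open>k\<close> goes
  right behind its code in the word of the values above \<open>k\<close>, or in front of that word
  if the code is \<open>k\<close> itself.\<close>

lemma word_code_determines_order:
  assumes p: "p permutes {1..n}" and q: "q permutes {1..n}"
    and eq: "word_code n p = word_code n q"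
    and "1 \<le> k" "k \<le> Suc n" "i \<in> {k..n}" "j \<in> {k..n}"
  shows "p i \<le> p j \<longleftrightarrow> q i \<le> q j"
  using assms(5,4,6,7)
proof (induction k arbitrary: i j rule: inc_induct)
  case (step k)
  have k: "k \<in> {1..n}" using step by auto
  have cmp: "p x < p k \<longleftrightarrow> q x < q k" if x: "x \<in> {k<..n}" for x
  proof (cases "word_code n p k = k")
    case True
    then show ?thesis
      using word_code_before[OF p k x] word_code_before[OF q k x] eq by simp
  next
    case False
    then have "word_code n p k \<in> {Suc k..n}"
      using word_code_cases[OF k, of p] by (metis atLeastSucAtMost_greaterThanAtMost)
    then have "p x \<le> p (word_code n p k) \<longleftrightarrow> q x \<le> q (word_code n p k)"
      using x by (intro step.IH) auto
    then show ?thesis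
      using word_code_before[OF p k x] word_code_before[OF q k x] eq by simp
  qed
  have neq: "p x \<noteq> p k" "q x \<noteq> q k" if "x \<in> {k<..n}" for x
    using that permutes_inj[OF p] permutes_inj[OF q] by (auto dest: injD)
  consider "i = k" "j = k" | "i = k" "j \<in> {k<..n}" | "i \<in> {k<..n}" "j = k"
    | "i \<in> {Suc k..n}" "j \<in> {Suc k..n}"
    using step.prems by fastforce
  then show ?case
  proof cases
    case 2
    then show ?thesis using cmp[of j] by (simp flip: not_less)
  next
    case 3
    then show ?thesis using cmp[of i] neq[of i] by (simp add: le_less)
  next
    case 4
    then show ?thesis by (intro step.IH) auto
  qed auto
qed auto

lemma inj_on_word_code: "inj_on (word_code n) (perms_upto n)"
proof (rule inj_onI)
  fix p q assume "p \<in> perms_upto n" "q \<in> perms_upto n" and eq: "word_code n p = word_code n q"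
  then have p: "p permutes {1..n}" and q: "q permutes {1..n}" by (auto simp: perms_upto_def)
  show "p = q"
  proof
    fix i
    show "p i = q i"
    proof (cases "i \<in> {1..n}")
      case True
      then have "{j \<in> {1..n}. p j \<le> p i} = {j \<in> {1..n}. q j \<le> q i}"
        using word_code_determines_order[OF p q eq, of 1] by auto
      then show ?thesis using permutes_rank[OF p True] permutes_rank[OF q True] by simp
    next
      case False
      then show ?thesis using p q by (metis permutes_not_in)
    qed
  qed
qed

text \<open>Surjectivity comes from counting: both sets are finite with \<open>fact n\<close>
  elements.\<close>

lemma bij_betw_word_code: "bij_betw (word_code n) (perms_upto n) (codes n)"
  unfolding bij_betw_def
proof
  show "word_code n ` perms_upto n = codes n"
    using inj_on_word_code
    by (intro card_subset_eq finite_codes)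
      (auto simp: word_code_in_codes card_image card_codes card_perms_upto)
qed (rule inj_on_word_code)

text \<open>As long as the iterates stay below \<open>j\<close>, each of them is still placed after
  \<open>j\<close>: the code of such an iterate is the last larger value before it, hence placed no
  earlier than \<open>j\<close>. The climb is strict, so it reaches or passes
  \<open>j\<close>.\<close>

lemma word_code_reaches:
  assumes "p permutes {1..n}" "x \<in> {1..n}" "j \<in> {x<..n}" "p j < p x"
  shows "\<exists>i. j \<le> (word_code n p ^^ i) x"
  using assms(2-)
proof (induction "n - x" arbitrary: x rule: less_induct)
  case less
  let ?y = "word_code n p x"
  have y: "?y \<noteq> x" "p j \<le> p ?y"
    using word_code_before[OF assms(1) less.prems(1,2)] less.prems(3) by auto
  have y': "x \<le> ?y" "?y \<in> {1..n}"
    using codesD[OF word_code_in_codes less.prems(1)] by auto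
  show ?case
  proof (cases "j \<le> ?y")
    case True
    then show ?thesis by (intro exI[of _ 1]) simp
  next
    case False
    then have "p j \<noteq> p ?y" using permutes_inj[OF assms(1)] by (auto dest: injD)
    then have "\<exists>i. j \<le> (word_code n p ^^ i) ?y"
      using y y' False less.prems by (intro less.hyps) auto
    then obtain i where "j \<le> (word_code n p ^^ i) ?y" ..
    then show ?thesis by (intro exI[of _ "Suc i"]) (simp add: funpow_swap1)
  qed
qed

text \<open>If \<open>j\<close> precedes \<open>i\<close> and \<open>j > i + r\<close>, the iterates
  from \<open>i\<close> climb to \<open>j\<close> or beyond and break the bound. Conversely,
  iterates never move to the right in the word, so one exceeding \<open>x\<close> by more than
  \<open>r\<close> precedes \<open>x\<close> and forms a forbidden pair with it.\<close>

lemma short_word_code_iff: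
  assumes p: "p \<in> perms_upto n"
  shows "short_code n r (word_code n p) \<longleftrightarrow> p \<in> Av_2gap1 n r"
proof
  have perm: "p permutes {1..n}" using p by (simp add: perms_upto_def)
  let ?c = "word_code n p"
  note c = codes_funpow[OF word_code_in_codes[of n p]]
  {
    assume short: "short_code n r ?c"
    have False if "i \<in> {1..n}" "j \<in> {1..n}" "i < j" "j - i > r" "p i > p j" for i j
    proof -
      have "\<exists>t. j \<le> (?c ^^ t) i"
        using that by (intro word_code_reaches[OF perm]) auto
      then obtain t where "j \<le> (?c ^^ t) i" ..
      moreover have "(?c ^^ t) i \<le> i + r" using short that by (auto simp: short_code_def)
      ultimately show False using that by simp
    qed
    then show "p \<in> Av_2gap1 n r" using p by (auto simp: Av_2gap1_def occurs_2gap1_def)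
  next
    assume av: "p \<in> Av_2gap1 n r"
    show "short_code n r ?c"
      unfolding short_code_def
    proof (intro ballI allI)
      fix x t assume x: "x \<in> {1..n}"
      have le: "p ((?c ^^ t) x) \<le> p x"
      proof (induction t)
        case (Suc t)
        have "(?c ^^ t) x \<in> {1..n}" using c[OF x] by blast
        then have "p (?c ((?c ^^ t) x)) \<le> p ((?c ^^ t) x)"
          by (cases rule: word_code_cases[of "(?c ^^ t) x" n p]) auto
        then show ?case using Suc by simp
      qed simp
      show "(?c ^^ t) x \<le> x + r"
      proof (rule ccontr)
        assume far: "\<not> (?c ^^ t) x \<le> x + r"
        then have "p ((?c ^^ t) x) \<noteq> p x" using inj_eq[OF permutes_inj[OF perm]] by auto
        then have "occurs_2gap1 n r p"
          unfolding occurs_2gap1_def using x c[OF x, of t] le far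
          by (intro bexI[of _ x] bexI[of _ "(?c ^^ t) x"]) auto
        then show False using av by (simp add: Av_2gap1_def)
      qed
    qed
  }
qed


subsection \<open>Codes of cycle decompositions\<close>

text \<open>The head of the list is the outermost factor, so on increasing lists the transposition
  of the smallest index acts last.\<close>

primrec swaps :: "('a \<Rightarrow> 'a) \<Rightarrow> 'a list \<Rightarrow> 'a \<Rightarrow> 'a" where
  "swaps c [] = id"
| "swaps c (k # ks) = transpose k (c k) \<circ> swaps c ks"

definition code_perm :: "nat \<Rightarrow> (nat \<Rightarrow> nat) \<Rightarrow> nat \<Rightarrow> nat" where
  "code_perm n c = swaps c [1..<Suc n]"

lemma swaps_upt_Cons:
  "k \<le> n \<Longrightarrow> swaps c [k..<Suc n] = transpose k (c k) \<circ> swaps c [Suc k..<Suc n]"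
  by (simp add: upt_conv_Cons del: upt_Suc)

lemma swaps_upt_permutes:
  assumes "c \<in> codes n" "1 \<le> k" "k \<le> Suc n"
  shows "swaps c [k..<Suc n] permutes {k..n}"
  using assms(3,2)
proof (induction k rule: inc_induct)
  case base
  have "swaps c [Suc n..<Suc n] = id" by simp
  then show ?case by (simp only: permutes_id)
next
  case (step k)
  then have k: "k \<le> n" "k \<in> {1..n}" by auto
  have "swaps c [Suc k..<Suc n] permutes {k..n}"
    by (rule permutes_subset[OF step.IH]) auto
  moreover have "transpose k (c k) permutes {k..n}"
    using codesD[OF assms(1) k(2)] k by (intro permutes_swap_id) auto
  ultimately show ?case
    unfolding swaps_upt_Cons[OF k(1)] by (rule permutes_compose)
qed

text \<open>The factors with indices above \<open>k\<close> fix \<open>k\<close>, because a code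
  never decreases. So \<open>c k\<close> can be read off the product.\<close>

lemma swaps_upt_first:
  assumes "c \<in> codes n" "k \<in> {1..n}"
  shows "swaps c [k..<Suc n] k = c k"
proof -
  have "swaps c [Suc k..<Suc n] k = k"
    using assms by (intro permutes_not_in[OF swaps_upt_permutes]) auto
  then show ?thesis using assms by (simp add: swaps_upt_Cons del: upt_Suc)
qed

lemma swaps_upt_inj:
  assumes "c \<in> codes n" "d \<in> codes n" "1 \<le> k" "k \<le> Suc n"
    and "swaps c [k..<Suc n] = swaps d [k..<Suc n]" "x \<in> {k..n}"
  shows "c x = d x"
  using assms(4,3,5,6)
proof (induction k rule: inc_induct)
  case (step k)
  then have k: "k \<le> n" "k \<in> {1..n}" by auto
  have ck: "c k = d k"
    using swaps_upt_first[OF assms(1) k(2)] swaps_upt_first[OF assms(2) k(2)] step.prems by simp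
  then have "transpose k (c k) \<circ> swaps c [Suc k..<Suc n]
      = transpose k (c k) \<circ> swaps d [Suc k..<Suc n]"
    using step.prems swaps_upt_Cons[OF k(1)] by metis
  \<comment> \<open>A transposition is its own inverse, so the common outer factor cancels.\<close>
  then have "swaps c [Suc k..<Suc n] = swaps d [Suc k..<Suc n]"
    by (metis comp_assoc id_comp transpose_comp_involutory)
  then show ?case using step ck by (cases "x = k") auto
qed auto

lemma inj_on_code_perm: "inj_on (code_perm n) (codes n)"
proof (rule inj_onI)
  fix c d assume cd: "c \<in> codes n" "d \<in> codes n" "code_perm n c = code_perm n d"
  show "c = d"
  proof (rule PiE_ext)
    show "c \<in> (\<Pi>\<^sub>E k\<in>{1..n}. {k..n})" "d \<in> (\<Pi>\<^sub>E k\<in>{1..n}. {k..n})"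
      using cd by (simp_all add: codes_def)
    show "c x = d x" if "x \<in> {1..n}" for x
      using swaps_upt_inj[OF cd(1,2), of 1 x] cd(3) that by (simp add: code_perm_def del: upt_Suc)
  qed
qed

lemma code_perm_permutes: "c \<in> codes n \<Longrightarrow> code_perm n c permutes {1..n}"
  unfolding code_perm_def by (intro swaps_upt_permutes) auto

lemma bij_betw_code_perm: "bij_betw (code_perm n) (codes n) (perms_upto n)"
  unfolding bij_betw_def
proof
  have "code_perm n ` codes n \<subseteq> perms_upto n"
    using code_perm_permutes unfolding perms_upto_def by blast
  then show "code_perm n ` codes n = perms_upto n"
    using inj_on_code_perm
    by (intro card_subset_eq finite_perms_upto) (auto simp: card_image card_codes card_perms_upto)
qed (rule inj_on_code_perm)

text \<open>Multiplying by \<open>(k c\<^sub>k)\<close> inserts \<open>k\<close> before \<open>c\<^sub>k\<close> in its cycle, so cycles only grow.\<close>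

lemma code_in_orbit_swaps:
  assumes "c \<in> codes n" "1 \<le> k" "k \<le> Suc n" "x \<in> {k..n}"
  shows "c x \<in> orbit (swaps c [k..<Suc n]) x"
  using assms(3,2,4)
proof (induction k arbitrary: x rule: inc_induct)
  case (step k)
  let ?f = "swaps c [k..<Suc n]" and ?g = "swaps c [Suc k..<Suc n]"
  have k: "k \<le> n" "k \<in> {1..n}" using step by auto
  have fk: "?f k = c k" by (rule swaps_upt_first[OF assms(1) k(2)])
  have f: "?f y = transpose k (c k) (?g y)" for y
    using swaps_upt_Cons[OF k(1), of c] by simp
  have g: "?g permutes {Suc k..n}" using assms(1) k by (intro swaps_upt_permutes) auto
  show ?case
  proof (cases "x = k")
    case True
    then show ?thesis using fk orbit.base[of ?f k] by simp
  next
    case False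
    \<comment> \<open>One step of \<open>?g\<close> takes one step of \<open>?f\<close>, or two when
      it leads to \<open>c k\<close>: then \<open>?f\<close> passes through
      \<open>k\<close>.\<close>
    have grow: "?g y \<in> orbit ?f y" if "y \<in> {Suc k..n}" for y
    proof (cases "?g y = c k")
      case True
      then have "?f y = k" using f by simp
      then have "?f (?f y) = ?g y" using fk True by simp
      then show ?thesis by (metis orbit.base orbit.step)
    next
      case False
      moreover have "?g y \<noteq> k" using permutes_in_image[OF g, of y] that by auto
      ultimately have "?f y = ?g y" using f by simp
      then show ?thesis by (metis orbit.base)
    qed
    \<comment> \<open>The range is carried along because \<open>grow\<close> speaks only of elements
      above \<open>k\<close>.\<close>
    have "y \<in> orbit ?f x \<and> y \<in> {Suc k..n}" if "y \<in> orbit ?g x" for y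
      using that
    proof (induction rule: orbit.induct)
      case base
      show ?case using grow[of x] permutes_in_image[OF g, of x] False step.prems by auto
    next
      case (step y)
      then show ?case
        using grow[of y] permutes_in_image[OF g, of y] by (blast intro: orbit_trans)
    qed
    moreover have "c x \<in> orbit ?g x" using step.prems False by (intro step.IH) auto
    ultimately show ?thesis by blast
  qed
qed auto

lemma funpow_code_in_orbit:
  assumes "c \<in> codes n" "x \<in> {1..n}"
  shows "(c ^^ i) x \<in> orbit (code_perm n c) x"
proof (induction i)
  case 0
  \<comment> \<open>\<open>orbit\<close> collects images after at least one application, so this
    needs that a permutation with finite support returns to \<open>x\<close>.\<close>
  have "x \<in> orbit (code_perm n c) x"
    using permutation_permutes code_perm_permutes[OF assms(1)]
    by (metis finite_atLeastAtMost permutation_self_in_orbit)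
  then show ?case by simp
next
  case (Suc i)
  have "c ((c ^^ i) x) \<in> orbit (code_perm n c) ((c ^^ i) x)"
    using codes_funpow[OF assms, of i] unfolding code_perm_def
    by (intro code_in_orbit_swaps assms) auto
  then show ?case using Suc by (auto intro: orbit_trans)
qed

section \<open>Components of the functional graph of a code\<close>

definition meets :: "('a \<Rightarrow> 'a) \<Rightarrow> 'a \<Rightarrow> 'a \<Rightarrow> bool" where
  "meets c a b \<longleftrightarrow> (\<exists>i j. (c ^^ i) a = (c ^^ j) b)"

lemma meets_refl: "meets c a a"
  unfolding meets_def by blast

lemma meets_sym: "meets c a b \<Longrightarrow> meets c b a"
  unfolding meets_def by metis

lemma meets_trans:
  assumes "meets c a b" "meets c b d"
  shows "meets c a d"
proof -
  obtain i j k l where eq: "(c ^^ i) a = (c ^^ j) b" "(c ^^ k) b = (c ^^ l) d"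
    using assms unfolding meets_def by blast
  \<comment> \<open>Iterates of \<open>c\<close> commute, so \<open>k\<close> more steps from the
    first meeting point and \<open>j\<close> more from the second end at the same point.\<close>
  have "(c ^^ (k + i)) a = (c ^^ k) ((c ^^ j) b)" by (simp add: funpow_add eq)
  also have "\<dots> = (c ^^ j) ((c ^^ k) b)" by (simp flip: funpow_add[THEN fun_cong, unfolded comp_apply] add: add.commute)
  also have "\<dots> = (c ^^ (j + l)) d" by (simp add: funpow_add eq)
  finally show ?thesis unfolding meets_def by blast
qed

lemma meets_step: "meets c a (c a)"
  unfolding meets_def by (rule exI[of _ 1], rule exI[of _ 0]) simp

text \<open>Each transposition moves a point, if at all, along an edge joining some \<open>k\<close>
  and \<open>c k\<close>, hence within its component.\<close>

lemma meets_swaps: "meets c a (swaps c ks a)"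
proof (induction ks)
  case (Cons k ks)
  have "meets c x (transpose k (c k) x)" for x
    by (auto simp: transpose_def intro: meets_step meets_sym meets_refl)
  then show ?case using Cons by (auto intro: meets_trans)
qed (simp add: meets_refl)

text \<open>Counterpart of \<open>funpow_code_in_orbit\<close>: a cycle never leaves a component of
  \<open>c\<close>.\<close>

lemma meets_orbit: "b \<in> orbit (code_perm n c) a \<Longrightarrow> meets c a b"
proof (induction rule: orbit.induct)
  case base
  show ?case unfolding code_perm_def by (rule meets_swaps)
next
  case (step b)
  then show ?case unfolding code_perm_def using meets_swaps meets_trans by metis
qed

lemma short_code_iff_cycles_within:
  assumes c: "c \<in> codes n"
  shows "short_code n r c \<longleftrightarrow> code_perm n c \<in> cycles_within n r"
proof
  have perm: "code_perm n c permutes {1..n}" using c by (rule code_perm_permutes)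
  {
    assume short: "short_code n r c"
    \<comment> \<open>A common iterate lies at or above \<open>y\<close> and at most
      \<open>r\<close> above \<open>x\<close>. Exchanging the two points gives the bound on the
      absolute difference.\<close>
    have up: "y \<le> x + r" if xy: "meets c x y" "x \<in> {1..n}" "y \<in> {1..n}" for x y
    proof -
      obtain i j where "(c ^^ i) x = (c ^^ j) y" using xy unfolding meets_def by blast
      moreover have "(c ^^ i) x \<le> x + r" using short xy by (auto simp: short_code_def)
      ultimately show ?thesis using codes_funpow[OF c xy(3), of j] by simp
    qed
    have "\<bar>int a - int b\<bar> \<le> int r"
      if a: "a \<in> {1..n}" and b: "b \<in> orbit (code_perm n c) a" for a b
    proof -
      have "b \<in> {1..n}" using permutes_orbit_subset[OF perm a] b by blast
      then show ?thesis
        using up[of a b] up[of b a] meets_orbit[OF b] meets_sym[of c a b] a by force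
    qed
    then show "code_perm n c \<in> cycles_within n r"
      using perm by (auto simp: cycles_within_def perms_upto_def)
  next
    assume within: "code_perm n c \<in> cycles_within n r"
    show "short_code n r c"
      unfolding short_code_def
    proof (intro ballI allI)
      fix x i assume x: "x \<in> {1..n}"
      have "\<bar>int x - int ((c ^^ i) x)\<bar> \<le> int r"
        using within x funpow_code_in_orbit[OF c x] unfolding cycles_within_def by blast
      then show "(c ^^ i) x \<le> x + r" by linarith
    qed
  }
qed

section \<open>Restriction and composition of the two bijections\<close>

lemma bij_betw_Collect:
  assumes "bij_betw f A B" "\<And>x. x \<in> A \<Longrightarrow> P x \<longleftrightarrow> Q (f x)"
  shows "bij_betw f {x \<in> A. P x} {y \<in> B. Q y}"
  using assms by (auto simp: bij_betw_def inj_on_def)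

theorem theorem3p2:
  fixes n r :: nat
  assumes "n \<ge> 1"
  shows "(\<exists>f. bij_betw f (Av_2gap1 n r) (cycles_within n r))
         \<and> card (Av_2gap1 n r) = card (cycles_within n r)"
proof -
  have "bij_betw (word_code n) {p \<in> perms_upto n. p \<in> Av_2gap1 n r} {c \<in> codes n. short_code n r c}"
    by (rule bij_betw_Collect[OF bij_betw_word_code]) (simp add: short_word_code_iff)
  moreover have "bij_betw (code_perm n) {c \<in> codes n. short_code n r c}
      {s \<in> perms_upto n. s \<in> cycles_within n r}"
    by (rule bij_betw_Collect[OF bij_betw_code_perm]) (rule short_code_iff_cycles_within)
  ultimately have "bij_betw (code_perm n \<circ> word_code n)
      {p \<in> perms_upto n. p \<in> Av_2gap1 n r} {s \<in> perms_upto n. s \<in> cycles_within n r}"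
    by (rule bij_betw_trans)
  moreover have "{p \<in> perms_upto n. p \<in> Av_2gap1 n r} = Av_2gap1 n r"
    by (auto simp: Av_2gap1_def)
  moreover have "{s \<in> perms_upto n. s \<in> cycles_within n r} = cycles_within n r"
    by (auto simp: cycles_within_def)
  ultimately have "bij_betw (code_perm n \<circ> word_code n) (Av_2gap1 n r) (cycles_within n r)"
    by simp
  then show ?thesis using bij_betw_same_card by blast
qed

end
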